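(* Let $(D,\sqcap,\sqcup,\neg,\top,\bot)$ be a Boolean algebra (meet $\sqcap$, join $\sqcup$, complement $\neg$). Setting $\lrcorner a:=\neg a$ for all $a\in D$, the algebra $(D,\sqcup,\sqcap,\neg,\lrcorner,\top,\bot)$ is a double Boolean algebra which is both fully contextual and pure. Conversely, if $\mathbf D=(D,\sqcup,\sqcap,\neg,\lrcorner,\top,\bot)$ is a double Boolean algebra such that $\neg a=\lrcorner a$ and $\neg\neg a=a$ for all $a\in D$, then $(D,\sqcap,\sqcup,\neg,\top,\bot)$ is a Boolean algebra.
   Context: A double Boolean algebra (dBa) is an algebra $\mathbf{D}=(D,\sqcup,\sqcap,\neg,\lrcorner,\top,\bot)$ of type $(2,2,1,1,0,0)$ such that, with $x\vee y:=\neg(\neg x\sqcap\neg y)$ and $x\wedge y:=\lrcorner(\lrcorner x\sqcup\lrcorner y)$, for all $x,y,z\in D$: $(x\sqcap x)\sqcap y=x\sqcap y$; $x\sqcap y=y\sqcap x$; $x\sqcap(y\sqcap z)=(x\sqcap y)\sqcap z$; $\neg(x\sqcap x)=\neg x$; $x\sqcap(x\sqcup y)=x\sqcap x$; $x\sqcap(y\vee z)=(x\sqcap y)\vee(x\sqcap z)$; $x\sqcap(x\vee y)=x\sqcap x$; $\neg\neg(x\sqcap y)=x\sqcap y$; $x\sqcap\neg x=\bot$; $\neg\bot=\top\sqcap\top$; $\neg\top=\bot$; the duals $(x\sqcup x)\sqcup y=x\sqcup y$; $x\sqcup y=y\sqcup x$; $x\sqcup(y\sqcup z)=(x\sqcup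 y)\sqcup z$; $\lrcorner(x\sqcup x)=\lrcorner x$; $x\sqcup(x\sqcap y)=x\sqcup x$; $x\sqcup(y\wedge z)=(x\sqcup y)\wedge(x\sqcup z)$; $x\sqcup(x\wedge y)=x\sqcup x$; $\lrcorner\lrcorner(x\sqcup y)=x\sqcup y$; $x\sqcup\lrcorner x=\top$; $\lrcorner\top=\bot\sqcup\bot$; $\lrcorner\bot=\top$; and $(x\sqcap x)\sqcup(x\sqcap x)=(x\sqcup x)\sqcap(x\sqcup x)$. The quasi-order is $x\sqsubseteq y$ iff $x\sqcap y=x\sqcap x$ and $x\sqcup y=y\sqcup y$. $x_\sqcap:=x\sqcap x$, $x_\sqcup:=x\sqcup x$, $D_\sqcap:=\{x:x_\sqcap=x\}$, $D_\sqcup:=\{x:x_\sqcup=x\}$. $\mathbf D$ is pure if every $x$ satisfies $x_\sqcap=x$ or $x_\sqcup=x$; fully contextual if $\sqsubseteq$ is a partial order and for all $y\in D_\sqcap$, $x\in D_\sqcup$ with $y_\sqcup=x_\sqcap$ there is a unique $z\in D$ with $z_\sqcap=y$ and $z_\sqcup=x$. *)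

theory Defs
  imports Main
begin

text \<open>
  The carrier of an algebra is the universe of the type \<open>'a\<close>, as in the library locale
  \<open>abstract_boolean_algebra\<close>. The operations \<open>\<sqinter>\<close> and \<open>\<squnion>\<close> need not be idempotent, so they are
  in general different from \<open>\<curlywedge>\<close> and \<open>\<curlyvee>\<close>, which stand for the derived operations
  \<open>x \<and> y\<close> and \<open>x \<or> y\<close>; \<open>opp\<close> is the second negation \<open>\<lrcorner>\<close>.
\<close>

locale double_boolean_signature =
  fixes join :: "'a \<Rightarrow> 'a \<Rightarrow> 'a"  (infixl "\<squnion>" 65)
    and meet :: "'a \<Rightarrow> 'a \<Rightarrow> 'a"  (infixl "\<sqinter>" 70)
    and neg :: "'a \<Rightarrow> 'a"
    and opp :: "'a \<Rightarrow> 'a"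
    and Top :: "'a"
    and Bot :: "'a"
begin

definition vee :: "'a \<Rightarrow> 'a \<Rightarrow> 'a"  (infixl "\<curlyvee>" 65)
  where "x \<curlyvee> y = neg (neg x \<sqinter> neg y)"

definition wedge :: "'a \<Rightarrow> 'a \<Rightarrow> 'a"  (infixl "\<curlywedge>" 70)
  where "x \<curlywedge> y = opp (opp x \<squnion> opp y)"

definition qle :: "'a \<Rightarrow> 'a \<Rightarrow> bool"  (infix "\<sqsubseteq>" 50)
  where "x \<sqsubseteq> y \<longleftrightarrow> x \<sqinter> y = x \<sqinter> x \<and> x \<squnion> y = y \<squnion> y"

definition meet_part :: "'a \<Rightarrow> 'a"
  where "meet_part x = x \<sqinter> x"

definition join_part :: "'a \<Rightarrow> 'a"
  where "join_part x = x \<squnion> x"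

definition D_meet :: "'a set"
  where "D_meet = {x. meet_part x = x}"

definition D_join :: "'a set"
  where "D_join = {x. join_part x = x}"

end

locale double_boolean_algebra = double_boolean_signature +
  assumes meet_idem_left: "(x \<sqinter> x) \<sqinter> y = x \<sqinter> y"
    and meet_commute: "x \<sqinter> y = y \<sqinter> x"
    and meet_assoc: "x \<sqinter> (y \<sqinter> z) = (x \<sqinter> y) \<sqinter> z"
    and neg_meet_idem: "neg (x \<sqinter> x) = neg x"
    and meet_join_absorb: "x \<sqinter> (x \<squnion> y) = x \<sqinter> x"
    and meet_vee_distrib: "x \<sqinter> (y \<curlyvee> z) = (x \<sqinter> y) \<curlyvee> (x \<sqinter> z)"
    and meet_vee_absorb: "x \<sqinter> (x \<curlyvee> y) = x \<sqinter> x"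
    and neg_neg_meet: "neg (neg (x \<sqinter> y)) = x \<sqinter> y"
    and meet_neg: "x \<sqinter> neg x = Bot"
    and neg_Bot: "neg Bot = Top \<sqinter> Top"
    and neg_Top: "neg Top = Bot"
    and join_idem_left: "(x \<squnion> x) \<squnion> y = x \<squnion> y"
    and join_commute: "x \<squnion> y = y \<squnion> x"
    and join_assoc: "x \<squnion> (y \<squnion> z) = (x \<squnion> y) \<squnion> z"
    and opp_join_idem: "opp (x \<squnion> x) = opp x"
    and join_meet_absorb: "x \<squnion> (x \<sqinter> y) = x \<squnion> x"
    and join_wedge_distrib: "x \<squnion> (y \<curlywedge> z) = (x \<squnion> y) \<curlywedge> (x \<squnion> z)"
    and join_wedge_absorb: "x \<squnion> (x \<curlywedge> y) = x \<squnion> x"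
    and opp_opp_join: "opp (opp (x \<squnion> y)) = x \<squnion> y"
    and join_opp: "x \<squnion> opp x = Top"
    and opp_Top: "opp Top = Bot \<squnion> Bot"
    and opp_Bot: "opp Bot = Top"
    and meet_join_idem: "(x \<sqinter> x) \<squnion> (x \<sqinter> x) = (x \<squnion> x) \<sqinter> (x \<squnion> x)"

locale pure_double_boolean_algebra = double_boolean_algebra +
  assumes pure: "meet_part x = x \<or> join_part x = x"

locale fully_contextual_double_boolean_algebra = double_boolean_algebra +
  assumes qle_partial_order: "partial_order_on UNIV {(x, y). x \<sqsubseteq> y}"
    and unique_glueing:
      "\<lbrakk>y \<in> D_meet; x \<in> D_join; join_part y = meet_part x\<rbrakk>
        \<Longrightarrow> \<exists>!z. meet_part z = y \<and> join_part z = x"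

end

theory Submission
  imports Defs
begin

text \<open>
  In a double Boolean algebra whose negations coincide and are involutive, both operations are
  idempotent, so \<open>\<sqinter>\<close> and \<open>\<squnion>\<close> form a lattice. Both \<open>x \<squnion> y\<close> and \<open>x \<curlyvee> y\<close> are then
  least upper bounds of \<open>x\<close> and \<open>y\<close> in it, hence equal, which turns the distributive law for
  \<open>\<curlyvee>\<close> and (by De Morgan) the one for \<open>\<curlywedge>\<close> into those of a Boolean algebra.
\<close>

context double_boolean_algebra
begin

text \<open>\<open>neg\<close> does not distinguish \<open>x \<sqinter> x\<close> from
  \<open>x\<close>, and an involution is injective.\<close>

lemma meet_idem_if_neg_involutive:
  assumes "\<And>a. neg (neg a) = a"
  shows "x \<sqinter> x = x"
  by (metis assms neg_meet_idem)

lemma join_idem_if_opp_involutive: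
  assumes "\<And>a. opp (opp a) = a"
  shows "x \<squnion> x = x"
  by (metis assms opp_join_idem)

lemma join_eq_vee_if_idem:
  assumes meet_idem: "\<And>a. a \<sqinter> a = a" and join_idem: "\<And>a. a \<squnion> a = a"
  shows "x \<squnion> y = x \<curlyvee> y"
proof -
  have vee_commute: "x \<curlyvee> y = y \<curlyvee> x"
    by (simp add: vee_def meet_commute)
  \<comment> \<open>By absorption \<open>x \<squnion> y\<close> lies above both \<open>x\<close> and
    \<open>y\<close>, so distributing puts \<open>x \<curlyvee> y\<close> below it.\<close>
  have "(x \<squnion> y) \<sqinter> (x \<curlyvee> y) = ((x \<squnion> y) \<sqinter> x) \<curlyvee> ((x \<squnion> y) \<sqinter> y)"
    by (rule meet_vee_distrib)
  also have "\<dots> = x \<curlyvee> y"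
    by (metis join_commute meet_commute meet_idem meet_join_absorb)
  finally have le: "(x \<squnion> y) \<sqinter> (x \<curlyvee> y) = x \<curlyvee> y" .
  \<comment> \<open>The absorption law for \<open>\<curlyvee>\<close> is a statement about meets;
    \<open>join_meet_absorb\<close> turns it into one about joins.\<close>
  have x: "(x \<curlyvee> y) \<squnion> x = x \<curlyvee> y"
    by (metis join_idem join_meet_absorb meet_commute meet_idem meet_vee_absorb)
  have y: "(x \<curlyvee> y) \<squnion> y = x \<curlyvee> y"
    by (metis join_idem join_meet_absorb meet_commute meet_idem meet_vee_absorb vee_commute)
  have "(x \<squnion> y) \<squnion> (x \<curlyvee> y) = x \<curlyvee> y"
    by (metis x y join_assoc join_commute)
  \<comment> \<open>With \<open>u = x \<squnion> y\<close> and \<open>v = x \<curlyvee> y\<close>: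
    \<open>u = u \<sqinter> (u \<squnion> v) = u \<sqinter> v = v\<close>.\<close>
  then show ?thesis
    by (metis le meet_idem meet_join_absorb)
qed

lemma abstract_boolean_algebra_if_involutive:
  assumes neg_opp: "\<And>a. neg a = opp a" and neg_neg: "\<And>a. neg (neg a) = a"
  shows "abstract_boolean_algebra (\<sqinter>) (\<squnion>) neg Bot Top"
proof -
  have meet_idem: "x \<sqinter> x = x" for x
    using neg_neg by (rule meet_idem_if_neg_involutive)
  have join_idem: "x \<squnion> x = x" for x
    using neg_neg unfolding neg_opp by (rule join_idem_if_opp_involutive)
  have vee: "x \<curlyvee> y = x \<squnion> y" for x y
    using join_eq_vee_if_idem[OF meet_idem join_idem] by simp
  have wedge: "x \<curlywedge> y = x \<sqinter> y" for x y
    by (simp add: wedge_def neg_neg vee_def flip: neg_opp vee)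
  show ?thesis
  proof
    show "x \<squnion> (y \<sqinter> z) = (x \<squnion> y) \<sqinter> (x \<squnion> z)" for x y z
      using join_wedge_distrib by (simp add: wedge)
    show "x \<sqinter> (y \<squnion> z) = x \<sqinter> y \<squnion> x \<sqinter> z" for x y z
      using meet_vee_distrib by (simp add: vee)
    \<comment> \<open>\<open>Top\<close> is \<open>x \<squnion> opp x\<close>, so this is an
      absorption law; dually for \<open>Bot\<close> as \<open>x \<sqinter> neg x\<close>.\<close>
    show "x \<sqinter> Top = x" for x
      by (metis join_opp meet_idem meet_join_absorb)
    show "x \<squnion> Bot = x" for x
      by (metis join_idem join_meet_absorb meet_neg)
    show "x \<squnion> neg x = Top" for x
      by (simp add: neg_opp join_opp)
    show "a \<sqinter> b \<sqinter> c = a \<sqinter> (b \<sqinter> c)" for a b c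
      by (rule meet_assoc[symmetric])
    show "a \<squnion> b \<squnion> c = a \<squnion> (b \<squnion> c)" for a b c
      by (rule join_assoc[symmetric])
  qed (fact meet_commute join_commute meet_neg)+
qed

end

context abstract_boolean_algebra
begin

text \<open>By De Morgan the derived operations are the original join and meet, so each axiom
  becomes a Boolean identity.\<close>

lemma double_boolean_algebra:
  "double_boolean_algebra (\<^bold>\<squnion>) (\<^bold>\<sqinter>) compl compl \<^bold>1 \<^bold>0"
proof -
  have conj_absorb: "x \<^bold>\<sqinter> (x \<^bold>\<squnion> y) = x" for x y
    by (metis disj_zero_right conj_zero_left disj_conj_distrib)
  have disj_absorb: "x \<^bold>\<squnion> (x \<^bold>\<sqinter> y) = x" for x y
    by (metis conj_absorb conj_disj_distrib conj.idem)
  have vee: "double_boolean_signature.vee (\<^bold>\<sqinter>) compl = (\<^bold>\<squnion>)"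
    by (simp add: fun_eq_iff double_boolean_signature.vee_def)
  have wedge: "double_boolean_signature.wedge (\<^bold>\<squnion>) compl = (\<^bold>\<sqinter>)"
    by (simp add: fun_eq_iff double_boolean_signature.wedge_def)
  show ?thesis
    unfolding double_boolean_algebra_def vee wedge
    by (intro conjI allI)
      (simp_all add: conj_absorb disj_absorb conj.assoc disj.assoc,
        (rule conj.commute disj.commute conj_disj_distrib disj_conj_distrib)+)
qed

text \<open>Idempotence makes both parts of an element the element itself, and the quasi-order
  becomes the lattice order.\<close>

lemma fully_contextual_double_boolean_algebra:
  "fully_contextual_double_boolean_algebra (\<^bold>\<squnion>) (\<^bold>\<sqinter>) compl compl \<^bold>1 \<^bold>0"
proof -
  interpret dba: double_boolean_algebra "(\<^bold>\<squnion>)" "(\<^bold>\<sqinter>)" compl compl "\<^bold>1" "\<^bold>0"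
    by (rule double_boolean_algebra)
  have qle: "dba.qle x y \<longleftrightarrow> x \<^bold>\<sqinter> y = x" for x y
    unfolding dba.qle_def
    by (metis conj.idem disj.idem conj.commute disj.commute dba.join_meet_absorb)
  show ?thesis
  proof
    show "partial_order_on UNIV {(x, y). dba.qle x y}"
      unfolding partial_order_on_def preorder_on_def qle
      by (auto simp: refl_on_def intro!: transI antisymI) (metis conj.assoc, metis conj.commute)
    \<comment> \<open>The compatibility condition reads \<open>y = x\<close>, so the only glueing is
      \<open>x\<close> itself.\<close>
    show "\<exists>!z. dba.meet_part z = y \<and> dba.join_part z = x"
      if "dba.join_part y = dba.meet_part x" for x y
      using that by (simp add: dba.meet_part_def dba.join_part_def)
  qed
qed

lemma pure_double_boolean_algebra:
  "pure_double_boolean_algebra (\<^bold>\<squnion>) (\<^bold>\<sqinter>) compl compl \<^bold>1 \<^bold>0"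
proof -
  interpret dba: double_boolean_algebra "(\<^bold>\<squnion>)" "(\<^bold>\<sqinter>)" compl compl "\<^bold>1" "\<^bold>0"
    by (rule double_boolean_algebra)
  show ?thesis
    by unfold_locales (simp add: dba.meet_part_def)
qed

end

theorem mainTheorem12:
  fixes join meet :: "'a \<Rightarrow> 'a \<Rightarrow> 'a"
    and neg opp :: "'a \<Rightarrow> 'a"
    and Top Bot :: "'a"
  shows "(abstract_boolean_algebra meet join neg Bot Top \<longrightarrow>
            double_boolean_algebra join meet neg neg Top Bot \<and>
            fully_contextual_double_boolean_algebra join meet neg neg Top Bot \<and>
            pure_double_boolean_algebra join meet neg neg Top Bot) \<and>
         (double_boolean_algebra join meet neg opp Top Bot \<and>
            (\<forall>a. neg a = opp a) \<and> (\<forall>a. neg (neg a) = a) \<longrightarrow>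
            abstract_boolean_algebra meet join neg Bot Top)"
  by (auto intro: abstract_boolean_algebra.double_boolean_algebra
      abstract_boolean_algebra.fully_contextual_double_boolean_algebra
      abstract_boolean_algebra.pure_double_boolean_algebra
      double_boolean_algebra.abstract_boolean_algebra_if_involutive)

end
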